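(* For every finite set $D$ of positive integers, there is at most one germ-maximal $D$-avoiding set $S\subseteq\mathbb{N}$.
   Context: $\mathbb{N}=\{0,1,2,\dots\}$. For $S\subseteq\mathbb{N}$ put $S_q=\sum_{n\in S}q^n$ for $q\in(0,1)$. For $S,S'\subseteq\mathbb{N}$ write $S'\preceq S$ (the germ order) iff there exists $\epsilon>0$ such that $S'_q\le S_q$ for all $q\in(1-\epsilon,1)$; this is a partial order on subsets of $\mathbb{N}$. Write $S'\prec S$ if $S'\preceq S$ and $S'\neq S$. A set $S\subseteq\mathbb{N}$ is $D$-avoiding if no two elements of $S$ differ by an element of $D$. A $D$-avoiding set $S$ is germ-maximal if there is no $D$-avoiding set $S'$ with $S\prec S'$. *)

theory Defs
  imports "HOL-Analysis.Analysis"
begin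

text \<open>
  The series converges absolutely for \<open>\<bar>q\<bar> < 1\<close>; only \<open>q \<in> (0,1)\<close> is of interest.
\<close>

definition germ_sum :: "nat set \<Rightarrow> real \<Rightarrow> real" where
  "germ_sum S q = (\<Sum>\<^sub>\<infinity>n\<in>S. q ^ n)"

text \<open>
  The smaller set is the first argument.
  No upper bound on \<open>\<epsilon>\<close> is needed: any witness can be shrunk, so one with \<open>\<epsilon> \<le> 1\<close>,
  for which all \<open>q\<close> lie in \<open>(0,1)\<close>, exists whenever some witness does.
\<close>

definition germ_le :: "nat set \<Rightarrow> nat set \<Rightarrow> bool" where
  "germ_le S' S \<longleftrightarrow> (\<exists>\<epsilon>>0. \<forall>q\<in>{1 - \<epsilon><..<1}. germ_sum S' q \<le> germ_sum S q)"

definition germ_less :: "nat set \<Rightarrow> nat set \<Rightarrow> bool" where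
  "germ_less S' S \<longleftrightarrow> germ_le S' S \<and> S' \<noteq> S"

text \<open>The guard \<open>x < y\<close> keeps the subtraction on the naturals from truncating.\<close>

definition avoiding :: "nat set \<Rightarrow> nat set \<Rightarrow> bool" where
  "avoiding D S \<longleftrightarrow> (\<forall>x\<in>S. \<forall>y\<in>S. x < y \<longrightarrow> y - x \<notin> D)"

definition germ_maximal :: "nat set \<Rightarrow> nat set \<Rightarrow> bool" where
  "germ_maximal D S \<longleftrightarrow> avoiding D S \<and> \<not> (\<exists>S'. avoiding D S' \<and> germ_less S S')"

end

theory Submission
  imports Defs "HOL-Computational_Algebra.Polynomial"
begin

text \<open>
  Choosing a \<open>D\<close>-avoiding set one natural number at a time is a deterministic decision process
  with discount factor \<open>q\<close>: its state is the set of upcoming positions already forbidden by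
  earlier choices, and taking the current position earns the reward \<open>1\<close>.  Since \<open>D\<close> is finite,
  only finitely many states can occur.  The argument is Blackwell's theorem on the existence of a
  policy that is optimal for all discount factors close to \<open>1\<close>.

  For fixed \<open>q\<close>, the supremum \<open>best_value\<close> of the achievable discounted rewards satisfies
  Bellman's equation (lemma \<open>best_value_step\<close>), so it is attained by always taking a decision that
  realises the maximum in that equation.  This decision depends only on the state.  Hence
  every \<open>D\<close>-avoiding set is dominated at \<open>q\<close> by one of the sets \<open>policy_set D Q\<close>
  (lemma \<open>policy_set_dominates\<close>), and these form a finite family that does not depend on \<open>q\<close>.

  A policy drives the process through finitely many states, so \<open>policy_set D Q\<close> is eventually
  periodic and its germ is a rational function of \<open>q\<close>.  The difference of two rational functions
  has constant sign just to the left of \<open>1\<close>; therefore the finite family of policy sets is totally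
  preordered by \<open>germ_le\<close> and has a greatest member.  That member dominates every \<open>D\<close>-avoiding
  set in the germ order, so no other set can be germ-maximal.
\<close>

section \<open>Generating functions near 1\<close>

lemma germ_le_iff_eventually:
  "germ_le S' S \<longleftrightarrow> (\<forall>\<^sub>F q in at_left 1. germ_sum S' q \<le> germ_sum S q)"
proof
  assume "germ_le S' S"
  then obtain e where "e > 0" and e: "\<forall>q\<in>{1 - e<..<1}. germ_sum S' q \<le> germ_sum S q"
    by (auto simp: germ_le_def)
  then show "\<forall>\<^sub>F q in at_left 1. germ_sum S' q \<le> germ_sum S q"
    unfolding eventually_at_left[of 0 "1::real", simplified]
    by (intro exI[of _ "1 - e"]) auto
next
  assume "\<forall>\<^sub>F q in at_left 1. germ_sum S' q \<le> germ_sum S q"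
  then obtain b where "b < 1" "\<forall>y>b. y < 1 \<longrightarrow> germ_sum S' y \<le> germ_sum S y"
    unfolding eventually_at_left[of 0 "1::real", simplified] by blast
  then show "germ_le S' S"
    unfolding germ_le_def by (intro exI[of _ "1 - b"]) auto
qed

lemma eventually_at_left_1_unit_interval: "\<forall>\<^sub>F q in at_left (1::real). 0 < q \<and> q < 1"
  unfolding eventually_at_left[of 0 "1::real", simplified] by (intro exI[of _ 0]) auto

lemma germ_le_trans:
  assumes "germ_le A B" "germ_le B C"
  shows "germ_le A C"
  using assms unfolding germ_le_iff_eventually by eventually_elim simp

lemma summable_indicator_power:
  fixes q :: real
  assumes "0 < q" "q < 1"
  shows "summable (\<lambda>n. of_bool (n \<in> S) * q ^ n)"
  by (rule summable_comparison_test[OF _ summable_geometric[of q]])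
     (use assms in \<open>auto intro!: exI[of _ 0]\<close>)

lemma germ_sum_eq_suminf:
  assumes "0 < q" "q < 1"
  shows "germ_sum S q = (\<Sum>n. of_bool (n \<in> S) * q ^ n)"
proof -
  have "germ_sum S q = infsum (\<lambda>n. of_bool (n \<in> S) * q ^ n) UNIV"
    unfolding germ_sum_def by (rule infsum_cong_neutral) auto
  also have "\<dots> = (\<Sum>n. of_bool (n \<in> S) * q ^ n)"
    using assms summable_indicator_power[OF assms]
    by (intro infsumI norm_summable_imp_has_sum summable_sums) simp_all
  finally show ?thesis .
qed

lemma germ_sum_split:
  assumes "0 < q" "q < 1"
  shows "germ_sum S q = (\<Sum>n<a. of_bool (n \<in> S) * q ^ n) + q ^ a * germ_sum {n. n + a \<in> S} q"
proof -
  have "germ_sum S q =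
      (\<Sum>n. of_bool (n + a \<in> S) * q ^ (n + a)) + (\<Sum>n<a. of_bool (n \<in> S) * q ^ n)"
    unfolding germ_sum_eq_suminf[OF assms]
    by (rule suminf_split_initial_segment[OF summable_indicator_power[OF assms]])
  also have "(\<Sum>n. of_bool (n + a \<in> S) * q ^ (n + a))
      = (\<Sum>n. q ^ a * (of_bool (n \<in> {n. n + a \<in> S}) * q ^ n))"
    by (simp add: power_add mult_ac)
  also have "\<dots> = q ^ a * germ_sum {n. n + a \<in> S} q"
    unfolding germ_sum_eq_suminf[OF assms]
    by (rule suminf_mult[OF summable_indicator_power[OF assms]])
  finally show ?thesis by simp
qed

lemma germ_sum_step:
  assumes "0 < q" "q < 1"
  shows "germ_sum S q = of_bool (0 \<in> S) + q * germ_sum {n. Suc n \<in> S} q"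
  using germ_sum_split[OF assms, of S 1] by simp

lemma germ_sum_nonneg: "0 < q \<Longrightarrow> 0 \<le> germ_sum S q"
  unfolding germ_sum_def by (rule infsum_nonneg) auto

lemma germ_sum_le_geometric:
  assumes "0 < q" "q < 1"
  shows "germ_sum S q \<le> 1 / (1 - q)"
proof -
  have "germ_sum S q \<le> (\<Sum>n. q ^ n)"
    unfolding germ_sum_eq_suminf[OF assms]
    by (rule suminf_le) (use assms in \<open>auto intro: summable_indicator_power summable_geometric\<close>)
  then show ?thesis using suminf_geometric[of q] assms by simp
qed

section \<open>Comparability of eventually periodic sets\<close>

text \<open>
  A nonzero polynomial has a largest root below \<open>1\<close>, and by the intermediate value theorem its
  sign cannot change between that root and \<open>1\<close>.
\<close>
lemma poly_eventually_const_sign_at_left: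
  fixes R :: "real poly"
  shows "(\<forall>\<^sub>F q in at_left 1. 0 \<le> poly R q) \<or> (\<forall>\<^sub>F q in at_left 1. poly R q \<le> 0)"
proof (cases "R = 0")
  case False
  define Z where "Z = insert 0 {x. poly R x = 0 \<and> x < 1}"
  have "finite {x. poly R x = 0}" by (rule poly_roots_finite[OF False])
  then have finZ: "finite Z"
    unfolding Z_def by (auto intro: finite_subset[rotated])
  have "Max Z < 1" using finZ by (subst Max_less_iff) (auto simp: Z_def)
  have nz: "poly R x \<noteq> 0" if "Max Z < x" "x < 1" for x
  proof
    assume "poly R x = 0"
    then have "x \<in> Z" using that by (auto simp: Z_def)
    then show False using Max_ge[OF finZ] that by force
  qed
  show ?thesis
  proof (cases "\<exists>x. Max Z < x \<and> x < 1 \<and> poly R x < 0")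
    case True
    then obtain x where x: "Max Z < x" "x < 1" "poly R x < 0" by blast
    have "poly R y \<le> 0" if y: "Max Z < y" "y < 1" for y
    proof (rule ccontr)
      assume "\<not> poly R y \<le> 0"
      then have "poly R y > 0" by simp
      then have "\<exists>z. Max Z < z \<and> z < 1 \<and> poly R z = 0"
      proof (cases x y rule: linorder_cases)
        case less
        from poly_IVT_pos[OF this x(3) \<open>poly R y > 0\<close>] show ?thesis
          using x y by (meson less_trans)
      next
        case greater
        from poly_IVT_neg[OF this \<open>poly R y > 0\<close> x(3)] show ?thesis
          using x y by (meson less_trans)
      qed (use x(3) \<open>poly R y > 0\<close> in simp)
      then show False using nz by blast
    qed
    then show ?thesis
      unfolding eventually_at_left[of 0 "1::real", simplified] using \<open>Max Z < 1\<close> by blast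
  next
    case False
    then show ?thesis
      unfolding eventually_at_left[of 0 "1::real", simplified] using \<open>Max Z < 1\<close>
      by (meson not_le)
  qed
qed simp

definition eventually_periodic :: "nat set \<Rightarrow> bool" where
  "eventually_periodic S \<longleftrightarrow> (\<exists>a p. p > 0 \<and> (\<forall>n\<ge>a. n + p \<in> S \<longleftrightarrow> n \<in> S))"

text \<open>
  Splitting off the first \<open>a\<close> or the first \<open>a + p\<close> terms leaves the same tail up to the factor
  \<open>q ^ p\<close>; eliminating the tail from the two expressions gives the claim.
\<close>
lemma eventually_periodic_germ_sum_rational:
  assumes "eventually_periodic S"
  obtains p P where "p > 0"
    "\<And>q. 0 < q \<Longrightarrow> q < 1 \<Longrightarrow> (1 - q ^ p) * germ_sum S q = poly P q"
proof -
  obtain a p where p: "p > 0" and per: "\<And>n. n \<ge> a \<Longrightarrow> n + p \<in> S \<longleftrightarrow> n \<in> S"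
    using assms unfolding eventually_periodic_def by blast
  define A where "A k = (\<Sum>n<k. monom (of_bool (n \<in> S) :: real) n)" for k
  have A: "poly (A k) q = (\<Sum>n<k. of_bool (n \<in> S) * q ^ n)" for k q
    by (simp add: A_def poly_sum poly_monom)
  have "(1 - q ^ p) * germ_sum S q = poly (A (a + p) - monom 1 p * A a) q"
    if q: "0 < q" "q < 1" for q
  proof -
    have "{n. n + (a + p) \<in> S} = {n. n + a \<in> S}"
      using per[of "_ + a"] by (simp add: add_ac)
    then have "germ_sum S q = poly (A (a + p)) q + q ^ (a + p) * germ_sum {n. n + a \<in> S} q"
      using germ_sum_split[OF q, of S "a + p"] by (simp add: A)
    moreover have "germ_sum S q = poly (A a) q + q ^ a * germ_sum {n. n + a \<in> S} q"
      using germ_sum_split[OF q, of S a] by (simp add: A)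
    ultimately have "germ_sum S q - poly (A (a + p)) q = q ^ p * (germ_sum S q - poly (A a) q)"
      by (simp add: power_add)
    then show ?thesis by (simp add: poly_monom algebra_simps)
  qed
  with p show thesis by (rule that)
qed

lemma germ_le_linear_if_eventually_periodic:
  assumes "eventually_periodic S" "eventually_periodic T"
  shows "germ_le S T \<or> germ_le T S"
proof -
  obtain p P where p: "p > 0"
    and P: "\<And>q. 0 < q \<Longrightarrow> q < 1 \<Longrightarrow> (1 - q ^ p) * germ_sum S q = poly P q"
    using eventually_periodic_germ_sum_rational[OF assms(1)] by blast
  obtain r R where r: "r > 0"
    and R: "\<And>q. 0 < q \<Longrightarrow> q < 1 \<Longrightarrow> (1 - q ^ r) * germ_sum T q = poly R q"
    using eventually_periodic_germ_sum_rational[OF assms(2)] by blast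
  define U where "U = (1 - monom 1 p) * R - (1 - monom 1 r) * P"
  have pos: "(1 - q ^ p) * (1 - q ^ r) > 0" if "0 < q" "q < 1" for q :: real
    using that p r by (simp add: power_less_one_iff)
  have U: "poly U q = (1 - q ^ p) * (1 - q ^ r) * (germ_sum T q - germ_sum S q)"
    if "0 < q" "q < 1" for q
    by (simp add: U_def poly_monom algebra_simps flip: P[OF that] R[OF that])
  show ?thesis
    using poly_eventually_const_sign_at_left[of U]
  proof
    assume "\<forall>\<^sub>F q in at_left 1. 0 \<le> poly U q"
    then have "germ_le S T"
      unfolding germ_le_iff_eventually using eventually_at_left_1_unit_interval
    proof eventually_elim
      case (elim q)
      then show ?case
        using U[of q] mult_le_cancel_left_pos[OF pos[of q], of 0 "germ_sum T q - germ_sum S q"]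
        by simp
    qed
    then show ?thesis ..
  next
    assume "\<forall>\<^sub>F q in at_left 1. poly U q \<le> 0"
    then have "germ_le T S"
      unfolding germ_le_iff_eventually using eventually_at_left_1_unit_interval
    proof eventually_elim
      case (elim q)
      then show ?case
        using U[of q] mult_le_cancel_left_pos[OF pos[of q], of "germ_sum T q - germ_sum S q" 0]
        by simp
    qed
    then show ?thesis ..
  qed
qed

lemma finite_germ_le_greatest:
  assumes "finite \<F>" "\<F> \<noteq> {}" "\<And>S. S \<in> \<F> \<Longrightarrow> eventually_periodic S"
  shows "\<exists>M\<in>\<F>. \<forall>S\<in>\<F>. germ_le S M"
  using assms
proof (induction \<F> rule: finite_ne_induct)
  case (singleton S)
  then show ?case using germ_le_linear_if_eventually_periodic[of S S] by simp
next
  case (insert S \<F>)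
  then obtain M where M: "M \<in> \<F>" "\<forall>T\<in>\<F>. germ_le T M" by auto
  have "germ_le S M \<or> germ_le M S" "germ_le S S"
    using germ_le_linear_if_eventually_periodic insert.prems M(1) by blast+
  then show ?case using M germ_le_trans by blast
qed

section \<open>Stationary policies\<close>

text \<open>
  A state is the set \<open>F\<close> of positions, relative to the current one, that are forbidden.
  Taking the current position additionally forbids \<open>D\<close>; moving on by one position shifts all
  relative positions down.
\<close>
definition next_state :: "nat set \<Rightarrow> bool \<Rightarrow> nat set \<Rightarrow> nat set" where
  "next_state D b F = {n. Suc n \<in> (if b then F \<union> D else F)}"

text \<open>
  A policy is the set \<open>Q\<close> of states in which the current position is to be taken; the test
  \<open>0 \<notin> F\<close> makes every set \<open>Q\<close> a legal policy.
\<close>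
definition takes :: "nat set set \<Rightarrow> nat set \<Rightarrow> bool" where
  "takes Q F \<longleftrightarrow> 0 \<notin> F \<and> F \<in> Q"

primrec policy_state :: "nat set \<Rightarrow> nat set set \<Rightarrow> nat \<Rightarrow> nat set" where
  "policy_state D Q 0 = {}"
| "policy_state D Q (Suc n) = next_state D (takes Q (policy_state D Q n)) (policy_state D Q n)"

definition policy_set :: "nat set \<Rightarrow> nat set set \<Rightarrow> nat set" where
  "policy_set D Q = {n. takes Q (policy_state D Q n)}"

lemma policy_set_avoiding:
  assumes "\<forall>d\<in>D. d > 0"
  shows "avoiding D (policy_set D Q)"
proof -
  (* Taking x forbids x + d for every d in D, and each step moves that entry one place down. *)
  have forbidden: "j \<in> policy_state D Q (Suc x + i)"
    if "x \<in> policy_set D Q" "Suc (i + j) \<in> D" for x i j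
    using that(2)
  proof (induction i arbitrary: j)
    case 0
    then show ?case using that(1) by (auto simp: policy_set_def next_state_def)
  next
    case (Suc i)
    then have "Suc j \<in> policy_state D Q (Suc x + i)" by simp
    then show ?case by (simp add: next_state_def)
  qed
  show ?thesis
    unfolding avoiding_def
  proof (intro ballI impI notI)
    fix x y
    assume xy: "x \<in> policy_set D Q" "y \<in> policy_set D Q" "x < y" "y - x \<in> D"
    then have "Suc ((y - Suc x) + 0) \<in> D" by (simp add: Suc_diff_Suc)
    then have "0 \<in> policy_state D Q (Suc x + (y - Suc x))" by (rule forbidden[OF xy(1)])
    then show False using xy(2,3) by (simp add: policy_set_def takes_def)
  qed
qed

lemma policy_state_bounded:
  assumes "D \<subseteq> {..M}"
  shows "policy_state D Q n \<subseteq> {..M}"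
proof (induction n)
  case (Suc n)
  then show ?case using assms by (fastforce simp: next_state_def split: if_splits)
qed simp

text \<open>
  Decisions in states that never occur are irrelevant, so finitely many policies suffice.
\<close>
lemma policy_set_restrict:
  assumes "D \<subseteq> {..M}"
  shows "policy_set D (Q \<inter> Pow {..M}) = policy_set D Q"
proof -
  have takes: "takes (Q \<inter> Pow {..M}) (policy_state D Q n) = takes Q (policy_state D Q n)" for n
    using policy_state_bounded[OF assms, of Q n] by (simp add: takes_def)
  have "policy_state D (Q \<inter> Pow {..M}) n = policy_state D Q n" for n
    by (induction n) (simp_all add: takes)
  then show ?thesis by (simp add: policy_set_def takes)
qed

text \<open>
  Only finitely many states occur, so some state is visited twice; as each state determines the
  next one, the walk repeats from there on.
\<close>
lemma policy_set_eventually_periodic: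
  assumes "finite D"
  shows "eventually_periodic (policy_set D Q)"
proof -
  obtain M where M: "D \<subseteq> {..M}" using assms by (meson finite_nat_iff_bounded_le)
  have "range (policy_state D Q) \<subseteq> Pow {..M}" using policy_state_bounded[OF M] by blast
  then have "finite (range (policy_state D Q))" by (rule finite_subset) simp
  then have "\<not> inj (policy_state D Q)" using finite_imageD[of "policy_state D Q" UNIV] by auto
  then obtain a b where ab: "a < b" "policy_state D Q a = policy_state D Q b"
    unfolding inj_def by (metis linorder_neqE_nat)
  have shift: "policy_state D Q (a + k) = policy_state D Q (b + k)" for k
    by (induction k) (simp_all add: ab(2))
  have "policy_state D Q (n + (b - a)) = policy_state D Q n" if "n \<ge> a" for n
    using that ab(1) shift[of "n - a"] by (simp add: add.commute)
  then show ?thesis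
    unfolding eventually_periodic_def policy_set_def using ab(1)
    by (intro exI[of _ a] exI[of _ "b - a"]) auto
qed

section \<open>Bellman's equation\<close>

definition best_value :: "nat set \<Rightarrow> real \<Rightarrow> nat set \<Rightarrow> real" where
  "best_value D q F = (SUP S\<in>{S. avoiding D S \<and> S \<inter> F = {}}. germ_sum S q)"

lemma germ_sum_le_best_value:
  assumes "0 < q" "q < 1" "avoiding D S" "S \<inter> F = {}"
  shows "germ_sum S q \<le> best_value D q F"
  unfolding best_value_def
  by (rule cSUP_upper) (use assms germ_sum_le_geometric[OF assms(1,2)] in \<open>auto intro!: bdd_aboveI2\<close>)

lemma best_value_le:
  assumes "\<And>S. avoiding D S \<Longrightarrow> S \<inter> F = {} \<Longrightarrow> germ_sum S q \<le> c"
  shows "best_value D q F \<le> c"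
  unfolding best_value_def
  by (rule cSUP_least) (use assms in \<open>auto intro!: exI[of _ "{}"] simp: avoiding_def\<close>)

lemma best_value_bounds:
  assumes "0 < q" "q < 1"
  shows "0 \<le> best_value D q F" "best_value D q F \<le> 1 / (1 - q)"
proof -
  have "0 \<le> germ_sum {} q" by (rule germ_sum_nonneg[OF assms(1)])
  also have "\<dots> \<le> best_value D q F"
    by (rule germ_sum_le_best_value[OF assms]) (simp_all add: avoiding_def)
  finally show "0 \<le> best_value D q F" .
  show "best_value D q F \<le> 1 / (1 - q)"
    by (rule best_value_le) (rule germ_sum_le_geometric[OF assms])
qed

text \<open>
  A conflict of a later position with position \<open>0\<close> or with \<open>F\<close> is exactly what the next state
  records as forbidden, and conflicts between later positions are invariant under the shift.
  Because of this the past influences the future only through the state.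
\<close>
lemma admissible_step_iff:
  assumes "\<forall>d\<in>D. d > 0"
  shows "avoiding D S \<and> S \<inter> F = {} \<longleftrightarrow>
    (0 \<in> S \<longrightarrow> 0 \<notin> F) \<and> avoiding D {n. Suc n \<in> S} \<and>
    {n. Suc n \<in> S} \<inter> next_state D (0 \<in> S) F = {}" (is "?L \<longleftrightarrow> ?R")
proof
  assume L: ?L
  have "Suc y - Suc x \<notin> D" if "Suc x \<in> S" "Suc y \<in> S" "x < y" for x y
    using L that unfolding avoiding_def by blast
  moreover have "Suc n \<notin> D" if "0 \<in> S" "Suc n \<in> S" for n
    using L that unfolding avoiding_def by (metis diff_zero zero_less_Suc)
  ultimately show ?R using L by (auto simp: avoiding_def next_state_def)
next
  assume R: ?R
  have "y - x \<notin> D" if "x \<in> S" "y \<in> S" "x < y" for x y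
  proof (cases x)
    case 0
    with that obtain z where "y = Suc z" by (cases y) auto
    then show ?thesis using R that 0 by (auto simp: next_state_def)
  next
    case (Suc x')
    with that obtain y' where "y = Suc y'" by (cases y) auto
    then show ?thesis using R that Suc by (auto simp: avoiding_def)
  qed
  moreover have "n \<notin> F" if "n \<in> S" for n
    using R that by (cases n) (auto simp: next_state_def split: if_splits)
  ultimately show ?L by (auto simp: avoiding_def)
qed

text \<open>
  Any set admissible in the next state, shifted up by one and preceded by the decision \<open>b\<close>,
  competes in the supremum for \<open>F\<close>.
\<close>
lemma best_value_ge_decision:
  assumes D: "\<forall>d\<in>D. d > 0" and q: "0 < q" "q < 1" and b: "b \<longrightarrow> 0 \<notin> F"
  shows "of_bool b + q * best_value D q (next_state D b F) \<le> best_value D q F"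
proof -
  have "best_value D q (next_state D b F) \<le> (best_value D q F - of_bool b) / q"
  proof (rule best_value_le)
    fix T assume T: "avoiding D T" "T \<inter> next_state D b F = {}"
    define S where "S = (if b then {0} else {}) \<union> Suc ` T"
    have S: "0 \<in> S \<longleftrightarrow> b" "{n. Suc n \<in> S} = T" by (auto simp: S_def)
    have "avoiding D S \<and> S \<inter> F = {}"
      using T b by (subst admissible_step_iff[OF D]) (simp add: S)
    then have "germ_sum S q \<le> best_value D q F" using germ_sum_le_best_value[OF q] by blast
    then have "of_bool b + q * germ_sum T q \<le> best_value D q F"
      using germ_sum_step[OF q, of S] by (simp add: S)
    then show "germ_sum T q \<le> (best_value D q F - of_bool b) / q"
      using q by (simp add: field_simps)
  qed
  then show ?thesis using q by (simp add: field_simps)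
qed

text \<open>
  The equation says that taking the current position and continuing optimally loses nothing.
\<close>
definition optimal_policy :: "nat set \<Rightarrow> real \<Rightarrow> nat set set" where
  "optimal_policy D q = {F. best_value D q F = 1 + q * best_value D q (next_state D True F)}"

lemma best_value_step:
  assumes D: "\<forall>d\<in>D. d > 0" and q: "0 < q" "q < 1"
  defines "Q \<equiv> optimal_policy D q"
  shows "best_value D q F =
    of_bool (takes Q F) + q * best_value D q (next_state D (takes Q F) F)"
proof -
  define W where "W b = of_bool b + q * best_value D q (next_state D b F)" for b
  have "best_value D q F \<le> (if 0 \<in> F then W False else max (W True) (W False))"
  proof (rule best_value_le)
    fix S assume S: "avoiding D S" "S \<inter> F = {}"
    then have R: "0 \<in> S \<longrightarrow> 0 \<notin> F" "avoiding D {n. Suc n \<in> S}"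
      "{n. Suc n \<in> S} \<inter> next_state D (0 \<in> S) F = {}"
      using admissible_step_iff[OF D] by blast+
    have "germ_sum S q \<le> W (0 \<in> S)"
      unfolding germ_sum_step[OF q, of S] W_def
      using germ_sum_le_best_value[OF q R(2,3)] q by simp
    then show "germ_sum S q \<le> (if 0 \<in> F then W False else max (W True) (W False))"
      using R(1) by (cases "0 \<in> S") auto
  qed
  moreover have "W False \<le> best_value D q F"
    unfolding W_def by (rule best_value_ge_decision[OF D q]) simp
  moreover have "W True \<le> best_value D q F" if "0 \<notin> F"
    unfolding W_def by (rule best_value_ge_decision[OF D q]) (use that in simp)
  moreover have "takes Q F \<longleftrightarrow> 0 \<notin> F \<and> best_value D q F = W True"
    by (simp add: takes_def Q_def optimal_policy_def W_def)
  ultimately have "best_value D q F = W (takes Q F)"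
    by (cases "0 \<in> F"; cases "takes Q F") (auto simp: max_def split: if_splits)
  then show ?thesis by (simp add: W_def)
qed

text \<open>
  Unfolding Bellman's equation \<open>N\<close> times along the optimal policy expresses the optimal value
  as the first \<open>N\<close> terms of the policy's own value plus a remainder of order \<open>q ^ N\<close>, as values
  are bounded.
\<close>
lemma germ_sum_optimal_policy:
  assumes D: "\<forall>d\<in>D. d > 0" and q: "0 < q" "q < 1"
  shows "germ_sum (policy_set D (optimal_policy D q)) q = best_value D q {}"
proof -
  define st where "st = policy_state D (optimal_policy D q)"
  define P where "P = policy_set D (optimal_policy D q)"
  have unfold: "best_value D q {} =
      (\<Sum>n<N. of_bool (n \<in> P) * q ^ n) + q ^ N * best_value D q (st N)" for N
  proof (induction N)
    case (Suc N)
    have "best_value D q (st N) = of_bool (N \<in> P) + q * best_value D q (st (Suc N))"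
      using best_value_step[OF D q, of "st N"] by (simp add: st_def P_def policy_set_def)
    with Suc show ?case by (simp add: algebra_simps)
  qed (simp add: st_def)
  have "(\<lambda>N. q ^ N * best_value D q (st N)) \<longlonglongrightarrow> 0"
  proof (rule Lim_null_comparison)
    show "\<forall>\<^sub>F N in sequentially. norm (q ^ N * best_value D q (st N)) \<le> q ^ N * (1 / (1 - q))"
      using best_value_bounds[OF q] q
      by (intro always_eventually allI) (simp add: abs_mult mult_left_mono del: times_divide_eq_right)
    show "(\<lambda>N. q ^ N * (1 / (1 - q))) \<longlonglongrightarrow> 0"
      using q by (intro tendsto_mult_left_zero LIMSEQ_power_zero) simp
  qed
  then have "(\<lambda>N. best_value D q {} - q ^ N * best_value D q (st N)) \<longlonglongrightarrow> best_value D q {} - 0"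
    by (intro tendsto_diff tendsto_const)
  moreover have "best_value D q {} - q ^ N * best_value D q (st N)
      = (\<Sum>n<N. of_bool (n \<in> P) * q ^ n)" for N
    using unfold[of N] by simp
  ultimately have "(\<lambda>n. of_bool (n \<in> P) * q ^ n) sums best_value D q {}"
    by (simp add: sums_def)
  then show ?thesis
    unfolding germ_sum_eq_suminf[OF q] P_def[symmetric] by (rule sums_unique[symmetric])
qed

lemma policy_set_dominates:
  assumes "\<forall>d\<in>D. d > 0" "D \<subseteq> {..M}" "0 < q" "q < 1" "avoiding D S"
  shows "\<exists>Q\<in>Pow (Pow {..M}). germ_sum S q \<le> germ_sum (policy_set D Q) q"
proof
  let ?Q = "optimal_policy D q \<inter> Pow {..M}"
  show "?Q \<in> Pow (Pow {..M})" by blast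
  show "germ_sum S q \<le> germ_sum (policy_set D ?Q) q"
    using germ_sum_le_best_value[OF assms(3-5), of "{}"] germ_sum_optimal_policy[OF assms(1,3,4)]
    by (simp add: policy_set_restrict[OF assms(2)])
qed

section \<open>Uniqueness of the germ-maximal set\<close>

lemma ex_greatest_avoiding_germ:
  assumes "finite D" and pos: "\<forall>d\<in>D. d > 0"
  shows "\<exists>G. avoiding D G \<and> (\<forall>S. avoiding D S \<longrightarrow> germ_le S G)"
proof -
  obtain M where M: "D \<subseteq> {..M}" using assms(1) by (meson finite_nat_iff_bounded_le)
  define \<F> where "\<F> = policy_set D ` Pow (Pow {..M})"
  have fin: "finite \<F>" by (simp add: \<F>_def)
  have "\<exists>G\<in>\<F>. \<forall>T\<in>\<F>. germ_le T G"
    using policy_set_eventually_periodic[OF assms(1)]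
    by (intro finite_germ_le_greatest fin) (auto simp: \<F>_def)
  then obtain G where G: "G \<in> \<F>" "\<forall>T\<in>\<F>. germ_le T G" by blast
  have "avoiding D G" using G(1) policy_set_avoiding[OF pos] by (auto simp: \<F>_def)
  moreover have "germ_le S G" if S: "avoiding D S" for S
  proof -
    (* The policy set that dominates S varies with q, but G dominates all of them at once near 1. *)
    have "\<forall>\<^sub>F q in at_left 1. \<forall>T\<in>\<F>. germ_sum T q \<le> germ_sum G q"
      using G(2) fin by (simp add: eventually_ball_finite_distrib germ_le_iff_eventually)
    then show ?thesis
      unfolding germ_le_iff_eventually using eventually_at_left_1_unit_interval
    proof eventually_elim
      case (elim q)
      then obtain Q where "Q \<in> Pow (Pow {..M})" "germ_sum S q \<le> germ_sum (policy_set D Q) q"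
        using policy_set_dominates[OF pos M _ _ S] by blast
      moreover from this(1) elim(1) have "germ_sum (policy_set D Q) q \<le> germ_sum G q"
        unfolding \<F>_def by blast
      ultimately show ?case by linarith
    qed
  qed
  ultimately show ?thesis by blast
qed

theorem corollary8:
  fixes D :: "nat set"
  assumes "finite D" and "\<forall>d\<in>D. d > 0"
  shows "\<exists>\<^sub>\<le>\<^sub>1 S. germ_maximal D S"
proof -
  obtain G where "avoiding D G" "\<And>S. avoiding D S \<Longrightarrow> germ_le S G"
    using ex_greatest_avoiding_germ[OF assms] by blast
  then have "S = G" if "germ_maximal D S" for S
    using that unfolding germ_maximal_def germ_less_def by blast
  then show ?thesis by (intro Uniq_I) blast
qed

end
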